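(* There is a constant $C$ such that for every $n$, $s(n, \chi_{>3}) \leq \frac{21}{64} n^2 + Cn$, both when Mini moves first and when Max moves first.
   Context: Let $\mathcal{P}$ be a monotone increasing property of graphs on vertex set $[n]$. An edge $e \in \binom{[n]}{2}\setminus E(G)$ is legal with respect to a graph $G \notin \mathcal{P}$ if $G \cup \{e\} \notin \mathcal{P}$. The saturation game $(n,\mathcal{P})$: starting from the empty graph on $[n]$, two players, Mini and Max, alternately add a legal edge to the current graph $G$. The game ends when no legal edge exists. Max wants to maximize the number of edges of the final graph and Mini wants to minimize it. The score $s(n,\mathcal{P})$ is the number of edges of the final graph under optimal play by both players; it may depend on which player moves first. $\chi_{>k}$ denotes the property of having chromatic number at least $k+1$. *)

theory Defs
  imports Complex_Main
begin

text \<open>A graph on the vertex set \<open>[n] = {1..n}\<close> is given by its edge set, a subset of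
  \<open>all_edges n\<close>; a graph property for this vertex set is a predicate on edge sets.\<close>

definition all_edges :: "nat \<Rightarrow> nat set set" where
  "all_edges n = {e. e \<subseteq> {1..n} \<and> card e = 2}"

lemma finite_all_edges: "finite (all_edges n)"
  by (rule finite_subset[of _ "Pow {1..n}"]) (auto simp: all_edges_def)

definition monotone_increasing :: "nat \<Rightarrow> (nat set set \<Rightarrow> bool) \<Rightarrow> bool" where
  "monotone_increasing n P \<longleftrightarrow>
     (\<forall>G H. G \<subseteq> H \<and> H \<subseteq> all_edges n \<and> P G \<longrightarrow> P H)"

definition proper_colouring :: "nat \<Rightarrow> nat set set \<Rightarrow> nat \<Rightarrow> (nat \<Rightarrow> nat) \<Rightarrow> bool" where
  "proper_colouring n G k f \<longleftrightarrow>
     f ` {1..n} \<subseteq> {..<k} \<and> (\<forall>u v. {u, v} \<in> G \<longrightarrow> f u \<noteq> f v)"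

definition chromatic_number :: "nat \<Rightarrow> nat set set \<Rightarrow> nat" where
  "chromatic_number n G = (LEAST k. \<exists>f. proper_colouring n G k f)"

definition chi_gt :: "nat \<Rightarrow> nat \<Rightarrow> nat set set \<Rightarrow> bool" where
  "chi_gt k n G \<longleftrightarrow> chromatic_number n G \<ge> k + 1"

lemma monotone_increasing_chi_gt: "monotone_increasing n (chi_gt k n)"
  unfolding monotone_increasing_def
proof (intro allI impI, elim conjE)
  fix G H assume GH: "G \<subseteq> H" and H: "H \<subseteq> all_edges n" and G: "chi_gt k n G"
  have "proper_colouring n H (Suc n) id"
    unfolding proper_colouring_def
  proof (intro conjI allI impI)
    show "id ` {1..n} \<subseteq> {..<Suc n}" by auto
    fix u v assume "{u, v} \<in> H"
    with H have "{u, v} \<in> all_edges n" by (rule subsetD)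
    then have "card {u, v} = 2" unfolding all_edges_def by (rule CollectE) (rule conjunct2)
    then show "id u \<noteq> id v" by (cases "u = v") simp_all
  qed
  then have "\<exists>f. proper_colouring n H (Suc n) f" by (rule exI[of _ id])
  then have "\<exists>f. proper_colouring n H (chromatic_number n H) f"
    unfolding chromatic_number_def by (rule LeastI)
  then obtain f where f: "proper_colouring n H (chromatic_number n H) f" ..
  have "proper_colouring n G (chromatic_number n H) f"
    using f GH by (simp add: proper_colouring_def subset_iff)
  then have "\<exists>f. proper_colouring n G (chromatic_number n H) f" by (rule exI[of _ f])
  then have "chromatic_number n G \<le> chromatic_number n H"
    unfolding chromatic_number_def[of n G] by (rule Least_le)
  with G show "chi_gt k n H" by (simp add: chi_gt_def)
qed

definition legal_edges :: "nat \<Rightarrow> (nat set set \<Rightarrow> bool) \<Rightarrow> nat set set \<Rightarrow> nat set set" where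
  "legal_edges n P G = {e \<in> all_edges n - G. \<not> P (insert e G)}"

text \<open>The maximizing player is called \<open>Maxi\<close> because the constant \<^const>\<open>Max\<close> is the maximum of a
  finite set.\<close>

datatype player = Mini | Maxi

text \<open>\<open>game_value n P p G\<close> is the number of edges of the final graph under optimal play when
  the current graph is \<open>G\<close> and it is the turn of \<open>p\<close>, computed by backward induction.\<close>

function game_value :: "nat \<Rightarrow> (nat set set \<Rightarrow> bool) \<Rightarrow> player \<Rightarrow> nat set set \<Rightarrow> nat" where
  "game_value n P p G =
     (if legal_edges n P G = {} then card G
      else case p of
        Mini \<Rightarrow> Min ((\<lambda>e. game_value n P Maxi (insert e G)) ` legal_edges n P G)
      | Maxi \<Rightarrow> Max ((\<lambda>e. game_value n P Mini (insert e G)) ` legal_edges n P G))"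
  by pat_completeness auto
termination
proof (relation "measure (\<lambda>(n, P, p, G). card (all_edges n - G))")
  have *: "card (all_edges n - insert e G) < card (all_edges n - G)"
    if "e \<in> legal_edges n P G" for n P G e
    using that by (intro psubset_card_mono) (auto simp: legal_edges_def finite_all_edges)
  show "((n, P, Maxi, insert e G), (n, P, p, G)) \<in> measure (\<lambda>(n, P, p, G). card (all_edges n - G))"
    if "e \<in> legal_edges n P G" for n P p G e
    using *[OF that] by simp
  show "((n, P, Mini, insert e G), (n, P, p, G)) \<in> measure (\<lambda>(n, P, p, G). card (all_edges n - G))"
    if "e \<in> legal_edges n P G" for n P p G e
    using *[OF that] by simp
qed simp

declare game_value.simps [simp del]

definition score :: "nat \<Rightarrow> (nat set set \<Rightarrow> bool) \<Rightarrow> player \<Rightarrow> nat" where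
  "score n P first = game_value n P first {}"

end

theory Submission
  imports Defs
begin

text \<open>Mini plays all her edges at vertex \<open>1\<close>, so as to leave it with at most \<open>n / 4\<close>
  non-neighbours; the colour class of \<open>1\<close> in the final 3-partite graph then has at most
  \<open>n / 4 + 1\<close> vertices, and the best Max can hope for is parts of relative sizes
  \<open>1/4, 3/8, 3/8\<close>, which gives \<open>21/64 n\<^sup>2\<close> edges.
  A non-neighbour of \<open>1\<close> of degree at most one can always be joined to \<open>1\<close>, so only those
  of degree at least two may be lost. Give non-neighbours of \<open>1\<close> the weight
  \<open>1\<close>, \<open>2\<close> or \<open>4\<close> according to whether their degree is \<open>0\<close>, \<open>1\<close> or larger. Mini can answer
  every move of Max so that the total weight, corrected by an extra \<open>1\<close> if some vertex is exposed
  in the sense below, does not increase; initially it is \<open>n - 1\<close>.\<close>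

declare One_nat_def [simp del]

section \<open>Weights, exposed vertices and the potential\<close>

definition neighbours :: "nat set set \<Rightarrow> nat \<Rightarrow> nat set" where
  "neighbours G u = {w. {u, w} \<in> G}"

definition non_neighbours :: "nat \<Rightarrow> nat set set \<Rightarrow> nat set" where
  "non_neighbours n G = {u \<in> {1..n}. u \<noteq> 1 \<and> 1 \<notin> neighbours G u}"

definition weight :: "nat set set \<Rightarrow> nat \<Rightarrow> nat" where
  "weight G u =
     (if u = 1 \<or> 1 \<in> neighbours G u then 0
      else if neighbours G u = {} then 1
      else if is_singleton (neighbours G u) then 2
      else 4)"

definition total_weight :: "nat \<Rightarrow> nat set set \<Rightarrow> nat" where
  "total_weight n G = (\<Sum>u\<in>{1..n}. weight G u)"

text \<open>If a vertex \<open>u\<close> of weight \<open>2\<close> is not exposed, then Max cannot prevent Mini from joining it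
  to \<open>1\<close> by adding one edge at \<open>u\<close>: the neighbour \<open>x\<close> of \<open>u\<close> can be recoloured.\<close>

definition exposed :: "nat set set \<Rightarrow> nat \<Rightarrow> bool" where
  "exposed G u \<longleftrightarrow>
     weight G u = 2 \<and> \<not> (\<exists>x. neighbours G u = {x} \<and> neighbours G x = {1, u})"

text \<open>A single \<open>1\<close> is enough however many vertices are exposed: Mini has to draw
  on it only when a move of Max leaves no vertex of weight \<open>2\<close>.\<close>

definition potential :: "nat \<Rightarrow> nat set set \<Rightarrow> nat" where
  "potential n G = total_weight n G + (if \<exists>u. exposed G u then 1 else 0)"

definition three_colourable :: "nat \<Rightarrow> nat set set \<Rightarrow> bool" where
  "three_colourable n G \<longleftrightarrow> (\<exists>f. proper_colouring n G 3 f)"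

section \<open>Edges and neighbourhoods\<close>

lemma all_edges_doubletonD:
  assumes "G \<subseteq> all_edges n" "{u, w} \<in> G"
  shows "u \<noteq> w" "u \<in> {1..n}" "w \<in> {1..n}"
proof -
  have "{u, w} \<in> all_edges n"
    using assms by blast
  then have *: "{u, w} \<subseteq> {1..n}" "card {u, w} = 2"
    unfolding all_edges_def by blast+
  show "u \<in> {1..n}" "w \<in> {1..n}"
    using * by auto
  show "u \<noteq> w"
    using *(2) by auto
qed

lemma all_edgesE:
  assumes "e \<in> all_edges n"
  obtains a b where "e = {a, b}" "a \<noteq> b" "a \<in> {1..n}" "b \<in> {1..n}"
  using assms unfolding all_edges_def card_2_iff by auto

lemma doubleton_in_all_edges:
  "a \<noteq> b \<Longrightarrow> a \<in> {1..n} \<Longrightarrow> b \<in> {1..n} \<Longrightarrow> {a, b} \<in> all_edges n"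
  by (simp add: all_edges_def)

lemma neighbours_sym: "w \<in> neighbours G u \<longleftrightarrow> u \<in> neighbours G w"
  by (simp add: neighbours_def insert_commute)

lemma neighbours_empty [simp]: "neighbours {} u = {}"
  by (simp add: neighbours_def)

lemma neighbours_insert:
  "neighbours (insert {a, b} G) w =
     (if w = a then insert b (neighbours G a)
      else if w = b then insert a (neighbours G b)
      else neighbours G w)"
  by (rule set_eqI) (simp add: neighbours_def doubleton_eq_iff)

lemma not_in_neighbours_self: "G \<subseteq> all_edges n \<Longrightarrow> u \<notin> neighbours G u"
  using all_edges_doubletonD(1)[of G n u u] by (auto simp: neighbours_def)

section \<open>How a new edge changes the weights\<close>

lemma weight_apex [simp]: "weight G 1 = 0"
  by (simp add: weight_def)

lemma weight_cases: "weight G u \<in> {0, 1, 2, 4}"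
  by (simp add: weight_def)

lemma weight_eq_1_iff: "weight G u = 1 \<longleftrightarrow> u \<noteq> 1 \<and> neighbours G u = {}"
  by (auto simp: weight_def)

lemma weight_eq_2_iff:
  "weight G u = 2 \<longleftrightarrow> u \<noteq> 1 \<and> (\<exists>x. x \<noteq> 1 \<and> neighbours G u = {x})"
  by (auto simp: weight_def is_singleton_def)

lemma weight_eq_4_iff:
  "weight G u = 4 \<longleftrightarrow> u \<noteq> 1 \<and> 1 \<notin> neighbours G u \<and> neighbours G u \<noteq> {} \<and>
     \<not> is_singleton (neighbours G u)"
  by (auto simp: weight_def)

lemma weight_insert_other:
  "w \<noteq> a \<Longrightarrow> w \<noteq> b \<Longrightarrow> weight (insert {a, b} G) w = weight G w"
  by (simp add: weight_def neighbours_insert)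

lemma weight_insert_0:
  "weight G a = 0 \<Longrightarrow> weight (insert {a, b} G) a = 0"
  by (auto simp: weight_def neighbours_insert split: if_splits)

lemma weight_insert_1:
  "weight G a = 1 \<Longrightarrow> b \<noteq> 1 \<Longrightarrow> weight (insert {a, b} G) a = 2"
  unfolding weight_eq_1_iff weight_eq_2_iff neighbours_insert by simp

lemma weight_insert_2:
  assumes "weight G a = 2" "b \<noteq> 1" "b \<notin> neighbours G a"
  shows "weight (insert {a, b} G) a = 4"
proof -
  obtain x where x: "neighbours G a = {x}" "a \<noteq> 1" "x \<noteq> 1"
    using assms(1) unfolding weight_eq_2_iff by blast
  then have "neighbours (insert {a, b} G) a = {b, x}" "b \<noteq> x"
    using assms(3) by (simp_all add: neighbours_insert)
  moreover have "\<not> is_singleton {b, x}"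
    using \<open>b \<noteq> x\<close> by (auto simp: is_singleton_def)
  ultimately show ?thesis
    using x assms(2) by (simp add: weight_eq_4_iff)
qed

lemma weight_insert_4:
  assumes "weight G a = 4" "b \<noteq> 1"
  shows "weight (insert {a, b} G) a = 4"
proof -
  have "\<not> is_singleton (insert b (neighbours G a))"
    using assms(1) unfolding weight_eq_4_iff is_singleton_def
    by (metis insert_not_empty subset_insertI subset_singletonD)
  then show ?thesis
    using assms by (simp add: weight_eq_4_iff neighbours_insert)
qed

lemma weight_insert_apex: "weight (insert {1, u} G) u = 0"
  by (simp add: weight_def neighbours_insert)

text \<open>An edge affects the weights of its two ends only. The sums are arranged without
  subtraction, which would truncate on \<open>nat\<close>.\<close>

lemma total_weight_insert:
  assumes "a \<noteq> b" "a \<in> {1..n}" "b \<in> {1..n}"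
  shows "total_weight n (insert {a, b} G) + weight G a + weight G b =
    total_weight n G + weight (insert {a, b} G) a + weight (insert {a, b} G) b"
proof -
  have split: "total_weight n H = weight H a + weight H b + (\<Sum>u\<in>{1..n} - {a, b}. weight H u)"
    for H
  proof -
    have "total_weight n H = (\<Sum>u\<in>{a, b}. weight H u) + (\<Sum>u\<in>{1..n} - {a, b}. weight H u)"
      unfolding total_weight_def
      by (subst sum.subset_diff[of "{a, b}"]) (use assms in auto)
    then show ?thesis
      using assms(1) by simp
  qed
  have "(\<Sum>u\<in>{1..n} - {a, b}. weight (insert {a, b} G) u) = (\<Sum>u\<in>{1..n} - {a, b}. weight G u)"
    by (rule sum.cong) (auto simp: weight_insert_other)
  then show ?thesis
    by (simp add: split)
qed

lemma total_weight_insert_apex: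
  assumes "u \<noteq> 1" "u \<in> {1..n}"
  shows "total_weight n (insert {1, u} G) + weight G u = total_weight n G"
  using total_weight_insert[of 1 u n G] assms by (simp add: weight_insert_apex)

text \<open>This turns a bound by \<open>n\<close> on the total weight into Mini's goal of at most
  \<open>n / 4\<close> non-neighbours of \<open>1\<close>, once no vertex of weight \<open>1\<close>
  or \<open>2\<close> is left.\<close>

lemma total_weight_eq_non_neighbours:
  assumes "\<And>u. u \<in> {1..n} \<Longrightarrow> weight G u \<notin> {1, 2}"
  shows "total_weight n G = 4 * card (non_neighbours n G)"
proof -
  have "total_weight n G = (\<Sum>u\<in>{1..n}. if u \<in> non_neighbours n G then 4 else 0)"
    unfolding total_weight_def
  proof (rule sum.cong)
    fix u assume "u \<in> {1..n}"
    with assms[OF this] show "weight G u = (if u \<in> non_neighbours n G then 4 else 0)"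
      by (auto simp: weight_def non_neighbours_def split: if_splits)
  qed simp
  also have "\<dots> = (\<Sum>u\<in>non_neighbours n G. 4)"
    by (rule sum.mono_neutral_cong_right) (auto simp: non_neighbours_def)
  finally show ?thesis
    by simp
qed

lemma total_weight_empty: "n \<ge> 1 \<Longrightarrow> total_weight n {} = n - 1"
proof -
  assume "n \<ge> 1"
  have "total_weight n {} = (\<Sum>u\<in>{1..n} - {1}. weight {} u)"
    unfolding total_weight_def using \<open>n \<ge> 1\<close> by (subst sum.remove[of _ 1]) auto
  also have "\<dots> = (\<Sum>u\<in>{1..n} - {1}. 1)"
    by (rule sum.cong) (auto simp: weight_def)
  finally show ?thesis
    using \<open>n \<ge> 1\<close> by simp
qed

text \<open>Mini's goal is permanent: no later edge can undo it.\<close>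

lemma card_non_neighbours_antimono:
  assumes "G \<subseteq> H"
  shows "card (non_neighbours n H) \<le> card (non_neighbours n G)"
proof (rule card_mono)
  show "finite (non_neighbours n G)"
    by (simp add: non_neighbours_def)
  show "non_neighbours n H \<subseteq> non_neighbours n G"
    using assms unfolding non_neighbours_def neighbours_def by blast
qed

section \<open>Three-colourability and recolouring\<close>

lemma not_chi_gt_3_iff:
  assumes "G \<subseteq> all_edges n"
  shows "\<not> chi_gt 3 n G \<longleftrightarrow> three_colourable n G"
proof
  assume "three_colourable n G"
  then have "chromatic_number n G \<le> 3"
    unfolding three_colourable_def chromatic_number_def by (intro Least_le)
  then show "\<not> chi_gt 3 n G"
    by (simp add: chi_gt_def)
next
  assume *: "\<not> chi_gt 3 n G"
  have "id ` {1..n} \<subseteq> {..<Suc n}"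
    by auto
  then have "proper_colouring n G (Suc n) id"
    unfolding proper_colouring_def using all_edges_doubletonD(1)[OF assms] by simp
  then have "\<exists>k f. proper_colouring n G k f"
    by blast
  then have "\<exists>f. proper_colouring n G (chromatic_number n G) f"
    unfolding chromatic_number_def by (rule LeastI_ex)
  then obtain f where f: "proper_colouring n G (chromatic_number n G) f" ..
  have "chromatic_number n G \<le> 3"
    using * by (simp add: chi_gt_def)
  then have "{..<chromatic_number n G} \<subseteq> {..<3}"
    by simp
  with f have "proper_colouring n G 3 f"
    unfolding proper_colouring_def using subset_trans by metis
  then show "three_colourable n G"
    unfolding three_colourable_def by blast
qed

lemma third_colour: obtains c :: nat where "c < 3" "c \<noteq> p" "c \<noteq> q"
proof -
  have "0 \<notin> {p, q} \<or> 1 \<notin> {p, q} \<or> 2 \<notin> {p, q}"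
    by auto
  then show ?thesis
    using that[of 0] that[of 1] that[of 2] by auto
qed

lemma proper_colouring_3_iff:
  "proper_colouring n G 3 f \<longleftrightarrow>
     (\<forall>u\<in>{1..n}. f u < 3) \<and> (\<forall>u w. w \<in> neighbours G u \<longrightarrow> f u \<noteq> f w)"
  by (auto simp: proper_colouring_def neighbours_def)

text \<open>Only edges with an end in the recoloured set \<open>X\<close> need checking, and by
  symmetry they can be viewed from that end.\<close>

lemma proper_colouring_3_recolour:
  assumes "proper_colouring n G 3 f" "\<And>u. u \<notin> X \<Longrightarrow> g u = f u"
    and "\<And>u w. u \<in> X \<Longrightarrow> w \<in> neighbours G u \<Longrightarrow> g u \<noteq> g w"
    and "\<And>u. u \<in> X \<Longrightarrow> u \<in> {1..n} \<Longrightarrow> g u < 3"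
  shows "proper_colouring n G 3 g"
  unfolding proper_colouring_3_iff
proof (intro conjI ballI allI impI)
  fix u assume "u \<in> {1..n}"
  then show "g u < 3"
    using assms(1,2,4) by (cases "u \<in> X") (auto simp: proper_colouring_3_iff)
next
  fix u w assume w: "w \<in> neighbours G u"
  then have u: "u \<in> neighbours G w"
    by (simp add: neighbours_sym)
  show "g u \<noteq> g w"
  proof (cases "u \<in> X \<or> w \<in> X")
    case True
    then show ?thesis
      using assms(3)[OF _ w] assms(3)[OF _ u] by metis
  next
    case False
    then show ?thesis
      using assms(1,2) w by (simp add: proper_colouring_3_iff)
  qed
qed

lemma three_colourable_insert:
  assumes "proper_colouring n G 3 f" "f a \<noteq> f b"
  shows "three_colourable n (insert {a, b} G)"
proof -
  have "proper_colouring n (insert {a, b} G) 3 f"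
    using assms by (auto simp: proper_colouring_def doubleton_eq_iff)
  then show ?thesis
    by (auto simp: three_colourable_def)
qed

text \<open>Some colour differs from those of \<open>x\<close> and \<open>1\<close>, and
  \<open>u\<close> can take it.\<close>

lemma three_colourable_insert_apex:
  assumes "three_colourable n G" "u \<noteq> 1" "neighbours G u \<subseteq> {x}"
  shows "three_colourable n (insert {1, u} G)"
proof -
  obtain f where f: "proper_colouring n G 3 f"
    using assms by (auto simp: three_colourable_def)
  obtain c where c: "c < 3" "c \<noteq> f 1" "c \<noteq> f x"
    by (rule third_colour)
  have nu: "u \<notin> neighbours G u"
    using f by (auto simp: proper_colouring_3_iff)
  have "proper_colouring n G 3 (f(u := c))"
    by (rule proper_colouring_3_recolour[OF f, of "{u}"]) (use c nu assms(3) in auto)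
  then show ?thesis
    by (rule three_colourable_insert) (use c assms(2) in auto)
qed

text \<open>For the case that Max joins two vertices of degree at most one. First \<open>b\<close>
  is recoloured away from \<open>1\<close> and \<open>y\<close>, then \<open>a\<close> away from
  \<open>x\<close> and the new colour of \<open>b\<close>.\<close>

lemma three_colourable_insert_apex_adjacent:
  assumes "three_colourable n G" "a \<noteq> 1" "b \<noteq> 1" "a \<noteq> b"
    and "neighbours G a \<subseteq> {b, x}" "neighbours G b \<subseteq> {a, y}"
  shows "three_colourable n (insert {1, b} G)"
proof -
  obtain f where f: "proper_colouring n G 3 f"
    using assms by (auto simp: three_colourable_def)
  obtain c where c: "c < 3" "c \<noteq> f 1" "c \<noteq> f y"
    by (rule third_colour)
  obtain d where d: "d < 3" "d \<noteq> c" "d \<noteq> f x"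
    by (rule third_colour)
  have nu: "u \<notin> neighbours G u" for u
    using f by (auto simp: proper_colouring_3_iff)
  have "proper_colouring n G 3 (f(b := c, a := d))"
  proof (rule proper_colouring_3_recolour[OF f, of "{a, b}"])
    fix u w assume "u \<in> {a, b}" "w \<in> neighbours G u"
    then show "(f(b := c, a := d)) u \<noteq> (f(b := c, a := d)) w"
      using c d nu[of a] nu[of b] assms(4-6) by auto
  qed (use c d in auto)
  then show ?thesis
    by (rule three_colourable_insert) (use c assms(2-4) in auto)
qed

text \<open>The reason for the notion \<open>exposed\<close>: Max has joined \<open>a\<close> to
  \<open>b\<close>, but the old neighbour \<open>x\<close> of \<open>a\<close> is flexible, its only
  other neighbour being \<open>1\<close>.\<close>

lemma three_colourable_insert_apex_recolour:
  assumes "three_colourable n G" "a \<noteq> 1" "x \<noteq> 1" "x \<noteq> b" "b \<in> {1..n}"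
    and "neighbours G a = {x, b}" "neighbours G x = {1, a}"
  shows "three_colourable n (insert {1, a} G)"
proof -
  obtain f where f: "proper_colouring n G 3 f"
    using assms by (auto simp: three_colourable_def)
  have nu: "u \<notin> neighbours G u" for u
    using f by (auto simp: proper_colouring_3_iff)
  have ab: "a \<noteq> b" "a \<noteq> x"
    using nu[of a] assms by auto
  \<comment> \<open>If \<open>b\<close> shares the colour of \<open>1\<close>, then \<open>x\<close>
    keeps its colour; otherwise \<open>x\<close> takes that of \<open>b\<close>. Either way
    \<open>1\<close>, \<open>b\<close> and \<open>x\<close> use at most two colours, which leaves
    one for \<open>a\<close>.\<close>
  define d where "d = (if f b = f 1 then f x else f b)"
  obtain c where c: "c < 3" "c \<noteq> f 1" "c \<noteq> d"
    by (rule third_colour)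
  have "f x \<noteq> f 1" "f b < 3" "x \<in> {1..n} \<Longrightarrow> f x < 3"
    using f assms(5,7) unfolding proper_colouring_3_iff by blast+
  then have d: "x \<in> {1..n} \<Longrightarrow> d < 3" "d \<noteq> f 1" "c \<noteq> f b"
    using c(2,3) by (simp_all add: d_def split: if_splits)
  have "proper_colouring n G 3 (f(x := d, a := c))"
  proof (rule proper_colouring_3_recolour[OF f, of "{x, a}"])
    fix u w assume "u \<in> {x, a}" "w \<in> neighbours G u"
    then show "(f(x := d, a := c)) u \<noteq> (f(x := d, a := c)) w"
      using c d ab assms(2-4,6,7) by auto
  qed (use c d in auto)
  then show ?thesis
    by (rule three_colourable_insert) (use c assms(2,3) in auto)
qed

lemma three_colourable_insert_apex_light:
  assumes "three_colourable n G" "weight G u \<in> {1, 2}"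
  shows "three_colourable n (insert {1, u} G)"
proof -
  obtain x where "neighbours G u \<subseteq> {x}" "u \<noteq> 1"
    using assms(2) by (auto simp: weight_eq_1_iff weight_eq_2_iff)
  with assms(1) show ?thesis
    by (intro three_colourable_insert_apex)
qed

section \<open>Mini's reply to a move of Max\<close>

lemma potential_le: "potential n G \<le> total_weight n G + 1"
  by (simp add: potential_def)

text \<open>In these two situations Mini's reply only just restores the total weight, so the
  correction in \<open>potential\<close> must not newly appear. Only \<open>b\<close> could become
  exposed. If both weights are \<open>2\<close>, then \<open>b\<close> gets weight \<open>4\<close>;
  if both are \<open>1\<close>, then \<open>a\<close> is the only neighbour of \<open>b\<close> and
  has exactly the neighbours \<open>1\<close> and \<open>b\<close>.\<close>

lemma exposed_insert_adjacent:
  assumes ab: "a \<noteq> b" "b \<notin> neighbours G a"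
    and "weight G a = 1 \<and> weight G b = 1 \<or> weight G a = 2 \<and> weight G b = 2"
    and exp: "exposed (insert {1, a} (insert {a, b} G)) w"
  shows "exposed G w"
proof (rule ccontr)
  let ?H = "insert {1, a} (insert {a, b} G)"
  assume "\<not> exposed G w"
  have ne: "a \<noteq> 1" "b \<noteq> 1" "1 \<notin> neighbours G a" "1 \<notin> neighbours G b"
    using assms(3) by (auto simp: weight_def split: if_splits)
  have H: "neighbours ?H a = {1, b} \<union> neighbours G a" "neighbours ?H b = insert a (neighbours G b)"
    "\<And>u. u \<notin> {1, a, b} \<Longrightarrow> neighbours ?H u = neighbours G u"
    using ab ne by (auto simp: neighbours_insert)
  have wH: "weight ?H w = 2"
    using exp by (simp add: exposed_def)
  then have "w \<noteq> 1" "w \<noteq> a"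
    using H(1) by (auto simp: weight_eq_2_iff)
  show False
  proof (cases "w = b")
    case True
    have "a \<notin> neighbours G b"
      using ab(2) by (simp add: neighbours_sym)
    then have "weight G b = 1"
      using wH assms(3) H(2) True by (auto simp: weight_eq_2_iff)
    moreover from this have "weight G a = 1"
      using assms(3) by auto
    ultimately have "neighbours ?H b = {a} \<and> neighbours ?H a = {1, b}"
      using H(1,2) by (auto simp: weight_eq_1_iff)
    then show False
      using exp True by (auto simp: exposed_def)
  next
    case False
    then have nw: "neighbours ?H w = neighbours G w"
      using H(3) \<open>w \<noteq> 1\<close> \<open>w \<noteq> a\<close> by simp
    have "weight G w = 2"
      using wH unfolding weight_eq_2_iff nw .
    then obtain x where x: "neighbours G w = {x}" "neighbours G x = {1, w}" "x \<noteq> 1"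
      using \<open>\<not> exposed G w\<close> by (auto simp: exposed_def weight_eq_2_iff)
    \<comment> \<open>In \<open>G\<close> the vertex \<open>x\<close> is adjacent to
      \<open>1\<close>, whereas \<open>a\<close> and \<open>b\<close> are not; so \<open>x\<close>
      is neither of them.\<close>
    then have "neighbours ?H x = {1, w}"
      using H(3)[of x] ne by auto
    then show False
      using exp x nw by (auto simp: exposed_def)
  qed
qed

text \<open>Mini joins \<open>1\<close> to an end of Max's edge that had weight \<open>1\<close> or
  \<open>2\<close> where the recolouring lemmas permit it, and otherwise to any vertex of weight
  \<open>1\<close> or \<open>2\<close>. If there is none, every non-neighbour of \<open>1\<close>
  has weight \<open>4\<close> and the first alternative holds.\<close>

lemma Mini_answer:
  assumes G: "G \<subseteq> all_edges n" and e: "e \<in> all_edges n" "e \<notin> G"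
    and col: "three_colourable n (insert e G)" and pot: "potential n G < n"
  shows "4 * card (non_neighbours n (insert e G)) \<le> n \<or>
    (\<exists>u\<in>{1..n}. u \<noteq> 1 \<and> {1, u} \<notin> insert e G \<and>
      three_colourable n (insert {1, u} (insert e G)) \<and>
      potential n (insert {1, u} (insert e G)) < n)"
    (is "?done \<or> ?move")
proof -
  let ?G1 = "insert e G"
  have G1: "?G1 \<subseteq> all_edges n"
    using G e by auto
  have moveI: ?move
    if "weight ?G1 u \<noteq> 0" "u \<in> {1..n}" "three_colourable n (insert {1, u} ?G1)"
      "potential n (insert {1, u} ?G1) \<le> potential n G" for u
  proof -
    have "u \<noteq> 1" "{1, u} \<notin> ?G1"
      using that(1) by (auto simp: weight_def neighbours_def insert_commute split: if_splits)
    then show ?thesis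
      using that pot by (meson le_less_trans)
  qed
  \<comment> \<open>The bound is \<open>n\<close>, one more than \<open>potential n G < n\<close>
    yields; the last case of \<open>main\<close> uses this slack.\<close>
  have doneI: ?done if "\<And>u. u \<in> {1..n} \<Longrightarrow> weight ?G1 u \<notin> {1, 2}" "total_weight n ?G1 \<le> n"
    using total_weight_eq_non_neighbours[of n ?G1] that by simp
  have take: "total_weight n (insert {1, u} ?G1) + weight ?G1 u = total_weight n ?G1"
    if "u \<in> {1..n}" for u
  proof (cases "u = 1")
    case True
    \<comment> \<open>The degenerate pair \<open>{1, 1}\<close> changes no weight, so
      \<open>take\<close> can do without the condition \<open>u \<noteq> 1\<close>.\<close>
    have "weight (insert {1, 1} ?G1) w = weight ?G1 w" for w
      by (cases "w = 1") (simp_all only: weight_apex weight_insert_other not_False_eq_True)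
    then show ?thesis
      using True by (simp add: total_weight_def)
  qed (use total_weight_insert_apex that in blast)
  \<comment> \<open>Any vertex of weight \<open>1\<close> or \<open>2\<close> is worth at least the
    \<open>1\<close> that a newly exposed vertex may cost.\<close>
  have heavy: ?thesis if "total_weight n ?G1 \<le> total_weight n G"
  proof (cases "\<exists>u\<in>{1..n}. weight ?G1 u \<in> {1, 2}")
    case True
    then obtain u where u: "u \<in> {1..n}" "weight ?G1 u \<in> {1, 2}"
      by blast
    have "potential n (insert {1, u} ?G1) \<le> total_weight n G"
      using take[OF u(1)] u(2) that potential_le[of n "insert {1, u} ?G1"] by auto
    then have "potential n (insert {1, u} ?G1) \<le> potential n G"
      by (simp add: potential_def)
    then show ?thesis
      using moveI[of u] u three_colourable_insert_apex_light[OF col u(2)] by auto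
  next
    case False
    then show ?thesis
      using doneI that pot by (auto simp: potential_def)
  qed
  have main: ?thesis
    if eab: "e = {a, b}" and ab: "a \<noteq> b" "a \<in> {1..n}" "b \<in> {1..n}" "a \<noteq> 1" "b \<noteq> 1"
      and wt: "weight G a \<in> {1, 2}" "weight G b = weight G a \<or> weight G b \<noteq> 1"
    for a b
  proof -
    have nab: "b \<notin> neighbours G a" "a \<notin> neighbours G b"
      using e(2) eab by (auto simp: neighbours_def insert_commute)
    have e': "e = {b, a}"
      using eab by auto
    have tw: "total_weight n ?G1 + weight G a + weight G b =
        total_weight n G + weight ?G1 a + weight ?G1 b"
      using total_weight_insert[OF ab(1-3), of G] eab by simp
    have n1: "neighbours ?G1 a = insert b (neighbours G a)"
      "neighbours ?G1 b = insert a (neighbours G b)"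
      using ab(1) eab by (simp_all add: neighbours_insert)
    have small: "\<exists>x. neighbours G u \<subseteq> {x}" if "weight G u \<in> {1, 2}" for u
      using that by (auto simp: weight_eq_1_iff weight_eq_2_iff)
    have col_ab: "three_colourable n (insert {1, a} ?G1)" "three_colourable n (insert {1, b} ?G1)"
      if wb: "weight G b \<in> {1, 2}"
    proof -
      obtain x y where "neighbours G a \<subseteq> {x}" "neighbours G b \<subseteq> {y}"
        using small[OF wt(1)] small[OF wb] by blast
      then have "neighbours ?G1 a \<subseteq> {b, x}" "neighbours ?G1 b \<subseteq> {a, y}"
        using n1 by auto
      then show "three_colourable n (insert {1, a} ?G1)" "three_colourable n (insert {1, b} ?G1)"
        using three_colourable_insert_apex_adjacent[OF col] ab by blast+
    qed
    \<comment> \<open>After Mini's reply the total weight has changed by 0, -1, 0, -1 in the first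
      four cases, and by -2 in the fifth if she can take \<open>a\<close>. A loss of at least 1 pays
      for the correction; the two zeros rely on \<open>exposed_insert_adjacent\<close>.\<close>
    consider "weight G a = 1" "weight G b = 1" | "weight G a = 1" "weight G b = 2"
      | "weight G a = 2" "weight G b = 2" | "weight G a = 1" "weight G b \<in> {0, 4}"
      | "weight G a = 2" "weight G b \<in> {0, 4}"
      using wt weight_cases[of G b] by auto
    then show ?thesis
    proof cases
      case 1
      then have w: "weight ?G1 a = 2" "weight ?G1 b = 2"
        using weight_insert_1[of G a b] weight_insert_1[of G b a] ab eab e' by auto
      have "potential n (insert {1, a} ?G1) \<le> potential n G"
        using take[OF ab(2)] tw w 1 exposed_insert_adjacent[OF ab(1) nab(1)] eab
        by (auto simp: potential_def)
      then show ?thesis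
        using moveI[of a] w ab col_ab 1 by simp
    next
      case 2
      then have w: "weight ?G1 a = 2" "weight ?G1 b = 4"
        using weight_insert_1[of G a b] weight_insert_2[of G b a] ab eab e' nab by auto
      have "potential n (insert {1, b} ?G1) \<le> total_weight n G"
        using take[OF ab(3)] tw w 2 potential_le[of n "insert {1, b} ?G1"] by auto
      then have "potential n (insert {1, b} ?G1) \<le> potential n G"
        by (simp add: potential_def)
      then show ?thesis
        using moveI[of b] w ab col_ab 2 by simp
    next
      case 3
      then have w: "weight ?G1 a = 4" "weight ?G1 b = 4"
        using weight_insert_2[of G a b] weight_insert_2[of G b a] ab eab e' nab by auto
      have "potential n (insert {1, a} ?G1) \<le> potential n G"
        using take[OF ab(2)] tw w 3 exposed_insert_adjacent[OF ab(1) nab(1)] eab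
        by (auto simp: potential_def)
      then show ?thesis
        using moveI[of a] w ab col_ab 3 by simp
    next
      case 4
      then have w: "weight ?G1 a = 2" "weight ?G1 b = weight G b"
        using weight_insert_1[of G a b] weight_insert_0[of G b a] weight_insert_4[of G b a]
          ab eab e' by auto
      have "potential n (insert {1, a} ?G1) \<le> total_weight n G"
        using take[OF ab(2)] tw w 4 potential_le[of n "insert {1, a} ?G1"] by auto
      then have "potential n (insert {1, a} ?G1) \<le> potential n G"
        by (simp add: potential_def)
      then show ?thesis
        using moveI[of a] w ab three_colourable_insert_apex_light[OF col, of a] by simp
    next
      case 5
      then have w: "weight ?G1 a = 4" "weight ?G1 b = weight G b"
        using weight_insert_2[of G a b] weight_insert_0[of G b a] weight_insert_4[of G b a]
          ab eab e' nab by auto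
      show ?thesis
      proof (cases "exposed G a")
        case False
        then obtain x where x: "neighbours G a = {x}" "neighbours G x = {1, a}" "x \<noteq> 1"
          using 5 by (auto simp: exposed_def weight_eq_2_iff)
        then have "x \<noteq> b" "x \<noteq> a"
          using nab not_in_neighbours_self[OF G, of a] by auto
        then have "neighbours ?G1 x = {1, a}"
          using x eab by (simp add: neighbours_insert)
        moreover have "neighbours ?G1 a = {x, b}"
          using n1 x by auto
        ultimately have "three_colourable n (insert {1, a} ?G1)"
          using three_colourable_insert_apex_recolour[OF col] ab x \<open>x \<noteq> b\<close> by blast
        moreover have "potential n (insert {1, a} ?G1) \<le> total_weight n G"
          using take[OF ab(2)] tw w 5 potential_le[of n "insert {1, a} ?G1"] by auto
        then have "potential n (insert {1, a} ?G1) \<le> potential n G"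
          by (simp add: potential_def)
        ultimately show ?thesis
          using moveI[of a] w ab by simp
      next
        case True
        then have potG: "potential n G = total_weight n G + 1"
          by (auto simp: potential_def)
        have tw1: "total_weight n ?G1 = total_weight n G + 2"
          using tw w 5 by simp
        \<comment> \<open>Taking \<open>a\<close> may be illegal, but the correction is already
          counted in \<open>potential n G\<close>. Max has added 2; another vertex of weight
          \<open>2\<close> regains all of it, one of weight \<open>1\<close> only half.\<close>
        consider u where "u \<in> {1..n}" "weight ?G1 u = 2"
          | u where "u \<in> {1..n}" "weight ?G1 u = 1" "\<And>u. u \<in> {1..n} \<Longrightarrow> weight ?G1 u \<noteq> 2"
          | "\<And>u. u \<in> {1..n} \<Longrightarrow> weight ?G1 u \<notin> {1, 2}"
          by auto
        then show ?thesis
        proof cases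
          case (1 u)
          then have "potential n (insert {1, u} ?G1) \<le> potential n G"
            using take[of u] tw1 potG potential_le[of n "insert {1, u} ?G1"] by auto
          then show ?thesis
            using moveI[of u] 1 three_colourable_insert_apex_light[OF col, of u] by simp
        next
          case (2 u)
          \<comment> \<open>With no vertex of weight \<open>2\<close> left, none is exposed after
            the reply, so the correction vanishes and pays for the missing 1.\<close>
          have "\<not> exposed (insert {1, u} ?G1) w" for w
          proof
            assume "exposed (insert {1, u} ?G1) w"
            then have "weight (insert {1, u} ?G1) w = 2"
              by (simp add: exposed_def)
            moreover from this have "w \<noteq> 1" "w \<noteq> u"
              using weight_insert_apex[of u ?G1] by auto
            ultimately have w2: "weight ?G1 w = 2"
              by (simp add: weight_insert_other)
            then obtain x where "x \<in> neighbours ?G1 w"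
              by (auto simp: weight_eq_2_iff)
            then have "w \<in> {1..n}"
              using all_edges_doubletonD(2)[OF G1] by (auto simp: neighbours_def)
            then show False
              using 2(3) w2 by blast
          qed
          then have "potential n (insert {1, u} ?G1) \<le> potential n G"
            using take[of u] tw1 potG 2 by (simp add: potential_def)
          then show ?thesis
            using moveI[of u] 2 three_colourable_insert_apex_light[OF col, of u] by simp
        next
          case 3
          then show ?thesis
            using doneI tw1 potG pot by simp
        qed
      qed
    qed
  qed
  obtain a b where ab: "e = {a, b}" "a \<noteq> b" "a \<in> {1..n}" "b \<in> {1..n}"
    using e(1) by (rule all_edgesE)
  have ba: "e = {b, a}"
    using ab by auto
  have tw: "total_weight n ?G1 + weight G a + weight G b =
      total_weight n G + weight ?G1 a + weight ?G1 b"
    using total_weight_insert[OF ab(2-4), of G] ab by simp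
  \<comment> \<open>Up to swapping the ends, any pair outside the first three cases fits
    \<open>main\<close>.\<close>
  consider "a = 1" | "b = 1" | "a \<noteq> 1" "b \<noteq> 1" "weight G a \<in> {0, 4}" "weight G b \<in> {0, 4}"
    | "a \<noteq> 1" "b \<noteq> 1" "weight G a \<in> {1, 2}" "weight G b = weight G a \<or> weight G b \<noteq> 1"
    | "a \<noteq> 1" "b \<noteq> 1" "weight G b \<in> {1, 2}" "weight G a = weight G b \<or> weight G a \<noteq> 1"
    using weight_cases[of G a] weight_cases[of G b] by (cases "a = 1 \<or> b = 1") auto
  then show ?thesis
  proof cases
    case 1
    then show ?thesis
      using tw ab weight_insert_apex[of b G] by (intro heavy) simp
  next
    case 2
    then show ?thesis
      using tw ba weight_insert_apex[of a G] by (intro heavy) simp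
  next
    case 3
    then have "weight ?G1 a = weight G a" "weight ?G1 b = weight G b"
      using weight_insert_0[of G a b] weight_insert_4[of G a b]
        weight_insert_0[of G b a] weight_insert_4[of G b a] ab ba by auto
    then show ?thesis
      using tw by (intro heavy) simp
  next
    case 4
    then show ?thesis
      using main[of a b] ab by blast
  next
    case 5
    then show ?thesis
      using main[of b a] ab ba by blast
  qed
qed

section \<open>Counting the edges of the final graph\<close>

lemma card_edges_le:
  assumes G: "G \<subseteq> all_edges n" and col: "three_colourable n G"
    and nn: "4 * card (non_neighbours n G) \<le> n" and n: "n \<ge> 1"
  shows "real (card G) \<le> 21 / 64 * (real n)\<^sup>2 + 1 / 8 * real n"
proof -
  obtain f where f: "proper_colouring n G 3 f"
    using col by (auto simp: three_colourable_def)
  define A where "A = {u \<in> {1..n}. f u = f 1}"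
  \<comment> \<open>Besides the colour of \<open>1\<close> there are two more; \<open>B\<close> gets
    one of them, and \<open>D\<close>, the remainder, can only have the other.\<close>
  obtain c where c: "c < 3" "c \<noteq> f 1" "c \<noteq> f 1"
    by (rule third_colour)
  define B where "B = {u \<in> {1..n}. f u = c}"
  define D where "D = {1..n} - A - B"
  have fin: "finite A" "finite B" "finite D"
    by (auto simp: A_def B_def D_def)
  have f1: "f 1 < 3" and f3: "\<And>u. u \<in> {1..n} \<Longrightarrow> f u < 3"
    using f n by (auto simp: proper_colouring_3_iff)
  have eqD: "f u = f w" if "u \<in> D" "w \<in> D" for u w
  proof -
    have "f u < 3" "f w < 3" "f u \<notin> {f 1, c}" "f w \<notin> {f 1, c}"
      using that f3 by (auto simp: A_def B_def D_def)
    then show ?thesis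
      using c f1 by auto
  qed
  have "G \<subseteq> (\<lambda>(u, w). {u, w}) ` (A \<times> (B \<union> D) \<union> B \<times> D)"
  proof
    fix e assume "e \<in> G"
    then obtain u w where e: "e = {u, w}" "u \<in> {1..n}" "w \<in> {1..n}"
      using G all_edgesE[of e n] by (metis subsetD)
    have fuw: "f u \<noteq> f w"
      using f e \<open>e \<in> G\<close> by (auto simp: proper_colouring_def)
    have "u \<in> A \<union> B \<union> D" "w \<in> A \<union> B \<union> D"
      using e by (auto simp: D_def)
    moreover have "\<not> (u \<in> A \<and> w \<in> A)" "\<not> (u \<in> B \<and> w \<in> B)" "\<not> (u \<in> D \<and> w \<in> D)"
      using fuw eqD by (auto simp: A_def B_def)
    ultimately have "(u, w) \<in> A \<times> (B \<union> D) \<union> B \<times> D \<or> (w, u) \<in> A \<times> (B \<union> D) \<union> B \<times> D"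
      by auto
    moreover have "e = (\<lambda>(u, w). {u, w}) (u, w)" "e = (\<lambda>(u, w). {u, w}) (w, u)"
      using e by auto
    ultimately show "e \<in> (\<lambda>(u, w). {u, w}) ` (A \<times> (B \<union> D) \<union> B \<times> D)"
      by blast
  qed
  then have "card G \<le> card ((\<lambda>(u, w). {u, w}) ` (A \<times> (B \<union> D) \<union> B \<times> D))"
    using fin by (intro card_mono) auto
  also have "\<dots> \<le> card (A \<times> (B \<union> D) \<union> B \<times> D)"
    using fin by (intro card_image_le) auto
  also have "\<dots> \<le> card (A \<times> (B \<union> D)) + card (B \<times> D)"
    by (rule card_Un_le)
  also have "\<dots> \<le> card A * (card B + card D) + card B * card D"
    using card_Un_le[of B D] by (simp add: card_cartesian_product)
  finally have cG: "card G \<le> card A * (card B + card D) + card B * card D" .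
  have "{1..n} = A \<union> (B \<union> D)" "A \<inter> (B \<union> D) = {}" "B \<inter> D = {}"
    using c by (auto simp: A_def B_def D_def)
  then have sum: "n = card A + (card B + card D)"
    using fin card_Un_disjoint[of A "B \<union> D"] card_Un_disjoint[of B D]
    by (metis card_atLeastAtMost diff_Suc_1 finite_UnI)
  \<comment> \<open>No vertex of the colour of \<open>1\<close> is adjacent to \<open>1\<close>.
    Vertex \<open>1\<close> itself accounts for the additive term that becomes the linear
    error.\<close>
  have "A \<subseteq> insert 1 (non_neighbours n G)"
    using f by (auto simp: A_def non_neighbours_def proper_colouring_3_iff)
  then have "card A \<le> card (insert 1 (non_neighbours n G))"
    by (intro card_mono) (auto simp: non_neighbours_def)
  also have "\<dots> \<le> Suc (card (non_neighbours n G))"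
    by (rule card_insert_le_m1) auto
  finally have cA: "4 * card A \<le> n + 4"
    using nn by simp
  define x y z N where xyz: "x = real (card A)" "y = real (card B)" "z = real (card D)" "N = real n"
  have N: "N = x + (y + z)" "4 * x \<le> N + 4" "N \<ge> 0"
    using sum cA unfolding xyz by linarith+
  have "real (card G) \<le> x * (y + z) + y * z"
    using cG unfolding xyz by (metis of_nat_add of_nat_le_iff of_nat_mult)
  also have "\<dots> \<le> x * (N - x) + (N - x)\<^sup>2 / 4"
  proof -
    have "(N - x)\<^sup>2 / 4 - y * z = (y - z)\<^sup>2 / 4"
      unfolding N(1) by (simp add: power2_eq_square field_simps)
    moreover have "(y - z)\<^sup>2 \<ge> 0"
      by simp
    ultimately have "y * z \<le> (N - x)\<^sup>2 / 4"
      by linarith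
    then show ?thesis
      using N(1) by simp
  qed
  \<comment> \<open>The concave quadratic in \<open>x\<close> is written as its tangent at
    \<open>N / 4\<close> minus a square; the tangent increases in \<open>x\<close>, so
    \<open>x \<le> N / 4 + 1\<close> can then be inserted.\<close>
  also have "\<dots> = 19 / 64 * N\<^sup>2 + N * x / 8 - 3 / 4 * (x - N / 4)\<^sup>2"
    by (simp add: power2_eq_square field_simps)
  also have "\<dots> \<le> 19 / 64 * N\<^sup>2 + N * x / 8"
    by simp
  also have "\<dots> \<le> 21 / 64 * N\<^sup>2 + 1 / 8 * N"
    using mult_left_mono[OF N(2) N(3)] by (simp add: power2_eq_square field_simps)
  finally show ?thesis
    by (simp add: xyz)
qed

section \<open>Playing out the game\<close>

text \<open>Describes positions with Max to move. Once the first alternative holds Mini may play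
  anything, so the potential is no longer tracked.\<close>

definition winning_invariant :: "nat \<Rightarrow> nat set set \<Rightarrow> bool" where
  "winning_invariant n G \<longleftrightarrow> G \<subseteq> all_edges n \<and> three_colourable n G \<and>
     (4 * card (non_neighbours n G) \<le> n \<or> potential n G < n)"

text \<open>A vertex of weight \<open>1\<close> or \<open>2\<close> could still legally be joined to
  \<open>1\<close>, so at the end all nonzero weights are \<open>4\<close>.\<close>

lemma winning_invariant_final:
  assumes "winning_invariant n G" "legal_edges n (chi_gt 3 n) G = {}"
  shows "4 * card (non_neighbours n G) \<le> n"
proof (rule ccontr)
  assume not: "\<not> ?thesis"
  then have G: "G \<subseteq> all_edges n" "three_colourable n G" "potential n G < n"
    using assms(1) by (auto simp: winning_invariant_def)
  have "weight G u \<notin> {1, 2}" if u: "u \<in> {1..n}" for u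
  proof
    assume w: "weight G u \<in> {1, 2}"
    then have "u \<noteq> 1" "{1, u} \<notin> G"
      by (auto simp: weight_def neighbours_def insert_commute split: if_splits)
    moreover have sub: "insert {1, u} G \<subseteq> all_edges n"
      using G(1) doubleton_in_all_edges[of 1 u n] u \<open>u \<noteq> 1\<close> by auto
    ultimately have "{1, u} \<in> legal_edges n (chi_gt 3 n) G"
      using three_colourable_insert_apex_light[OF G(2) w] not_chi_gt_3_iff[OF sub]
      by (auto simp: legal_edges_def)
    then show False
      using assms(2) by simp
  qed
  then have "4 * card (non_neighbours n G) = total_weight n G"
    by (rule total_weight_eq_non_neighbours[symmetric])
  then show False
    using not G(3) by (simp add: potential_def)
qed

text \<open>The induction runs over rounds of two moves: for each move of Max, one reply that
  restores the invariant bounds the minimum over Mini's replies.\<close>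

lemma game_value_Maxi_le:
  assumes "winning_invariant n G" "n \<ge> 1"
  shows "real (game_value n (chi_gt 3 n) Maxi G) \<le> 21 / 64 * (real n)\<^sup>2 + 1 / 8 * real n"
  using assms(1)
proof (induction "card (all_edges n - G)" arbitrary: G rule: less_induct)
  case less
  let ?P = "chi_gt 3 n" and ?T = "21 / 64 * (real n)\<^sup>2 + 1 / 8 * real n"
  have G: "G \<subseteq> all_edges n" "three_colourable n G"
    using less.prems by (auto simp: winning_invariant_def)
  have finite_legal: "finite (legal_edges n ?P H)" for H
    by (rule finite_subset[OF _ finite_all_edges[of n]]) (auto simp: legal_edges_def)
  have reply: "real (game_value n ?P Mini (insert e G)) \<le> ?T" if e: "e \<in> legal_edges n ?P G" for e
  proof -
    have e': "e \<in> all_edges n" "e \<notin> G" "insert e G \<subseteq> all_edges n"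
      using e G by (auto simp: legal_edges_def)
    have col: "three_colourable n (insert e G)"
      using e not_chi_gt_3_iff[OF e'(3)] by (simp add: legal_edges_def)
    have nn_mono: "4 * card (non_neighbours n H) \<le> n"
      if "4 * card (non_neighbours n (insert e G)) \<le> n" "insert e G \<subseteq> H" for H
      using card_non_neighbours_antimono[OF that(2), of n] that(1) by linarith
    \<comment> \<open>If Mini has no legal reply, the second alternative fails and Mini's goal must
      already be reached.\<close>
    have dich: "4 * card (non_neighbours n (insert e G)) \<le> n \<or>
      (\<exists>f\<in>legal_edges n ?P (insert e G). winning_invariant n (insert f (insert e G)))"
    proof (cases "4 * card (non_neighbours n G) \<le> n")
      case True
      then show ?thesis
        using card_non_neighbours_antimono[OF subset_insertI, of n e G] by linarith
    next
      case False
      then have "potential n G < n"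
        using less.prems by (simp add: winning_invariant_def)
      from Mini_answer[OF G(1) e'(1,2) col this] show ?thesis
      proof
        assume "\<exists>u\<in>{1..n}. u \<noteq> 1 \<and> {1, u} \<notin> insert e G \<and>
          three_colourable n (insert {1, u} (insert e G)) \<and>
          potential n (insert {1, u} (insert e G)) < n"
        then obtain u where u: "u \<in> {1..n}" "u \<noteq> 1" "{1, u} \<notin> insert e G"
          "three_colourable n (insert {1, u} (insert e G))"
          "potential n (insert {1, u} (insert e G)) < n"
          by blast
        have 1: "{1, u} \<in> all_edges n"
          using u by (intro doubleton_in_all_edges) auto
        then have 2: "insert {1, u} (insert e G) \<subseteq> all_edges n"
          using e' by auto
        have "{1, u} \<in> legal_edges n ?P (insert e G)"
          using u(3,4) 1 not_chi_gt_3_iff[OF 2] by (simp add: legal_edges_def)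
        moreover have "winning_invariant n (insert {1, u} (insert e G))"
          using u 2 by (simp add: winning_invariant_def)
        ultimately show ?thesis
          by blast
      qed simp
    qed
    show ?thesis
    proof (cases "legal_edges n ?P (insert e G) = {}")
      case True
      then have "4 * card (non_neighbours n (insert e G)) \<le> n"
        using dich by auto
      then show ?thesis
        using card_edges_le[OF e'(3) col _ assms(2)] True by (simp add: game_value.simps)
    next
      case False
      obtain f where f: "f \<in> legal_edges n ?P (insert e G)"
        "winning_invariant n (insert f (insert e G))"
      \<comment> \<open>With the goal reached, an arbitrary legal edge keeps the invariant.\<close>
      proof (cases "4 * card (non_neighbours n (insert e G)) \<le> n")
        case True
        obtain f where f: "f \<in> legal_edges n ?P (insert e G)"
          using False by blast
        have sub: "insert f (insert e G) \<subseteq> all_edges n"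
          using f e' by (auto simp: legal_edges_def)
        then have "three_colourable n (insert f (insert e G))"
          using f not_chi_gt_3_iff[OF sub] by (simp add: legal_edges_def)
        then have "winning_invariant n (insert f (insert e G))"
          using sub nn_mono[OF True subset_insertI] by (simp add: winning_invariant_def)
        then show ?thesis
          by (rule that[OF f])
      next
        case False
        then show ?thesis
          using dich that by (elim disjE bexE) auto
      qed
      have "f \<in> all_edges n"
        using f by (simp add: legal_edges_def)
      then have "card (all_edges n - insert f (insert e G)) < card (all_edges n - G)"
        using e' by (intro psubset_card_mono) (auto simp: finite_all_edges)
      then have IH: "real (game_value n ?P Maxi (insert f (insert e G))) \<le> ?T"
        using less.hyps[OF _ f(2)] by simp
      have "game_value n ?P Mini (insert e G) \<le> game_value n ?P Maxi (insert f (insert e G))"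
        using False f(1) finite_legal
        by (subst game_value.simps) (auto intro!: Min_le)
      then show ?thesis
        using IH by linarith
    qed
  qed
  show ?case
  proof (cases "legal_edges n ?P G = {}")
    case True
    then show ?thesis
      using card_edges_le[OF G winning_invariant_final[OF less.prems True] assms(2)]
      by (simp add: game_value.simps)
  next
    case False
    let ?vals = "(\<lambda>e. game_value n ?P Mini (insert e G)) ` legal_edges n ?P G"
    have "game_value n ?P Maxi G = Max ?vals"
      using False by (subst game_value.simps) simp
    moreover have "Max ?vals \<in> ?vals"
      using False finite_legal by (intro Max_in) auto
    ultimately show ?thesis
      using reply by auto
  qed
qed

theorem theorem1p4:
  shows "\<exists>C::real. \<forall>n::nat.
    real (score n (chi_gt 3 n) Mini) \<le> 21 / 64 * (real n)\<^sup>2 + C * real n \<and>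
    real (score n (chi_gt 3 n) Maxi) \<le> 21 / 64 * (real n)\<^sup>2 + C * real n"
proof (intro exI[of _ "1 / 8"] allI)
  fix n :: nat
  let ?P = "chi_gt 3 n" and ?T = "21 / 64 * (real n)\<^sup>2 + 1 / 8 * real n"
  have "proper_colouring n {} 3 (\<lambda>_. 0)"
    by (auto simp: proper_colouring_def)
  then have col: "three_colourable n {}"
    by (auto simp: three_colourable_def)
  have final: "real (game_value n ?P p {}) \<le> ?T" if "legal_edges n ?P {} = {}" for p
    using that by (simp add: game_value.simps)
  have Maxi: "real (score n ?P Maxi) \<le> ?T"
  \<comment> \<open>For \<open>n = 0\<close> there is no vertex \<open>1\<close>, and the potential
    cannot be below \<open>n\<close>.\<close>
  proof (cases "n = 0")
    case True
    then have "legal_edges n ?P {} = {}"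
      by (auto simp: legal_edges_def all_edges_def)
    then show ?thesis
      using final by (simp add: score_def)
  next
    case False
    then have "potential n {} < n"
      by (auto simp: potential_def total_weight_empty exposed_def weight_def)
    then have "winning_invariant n {}"
      using col by (simp add: winning_invariant_def)
    then show ?thesis
      using game_value_Maxi_le False by (simp add: score_def)
  qed
  have Mini: "real (score n ?P Mini) \<le> ?T"
  proof (cases "legal_edges n ?P {} = {}")
    case True
    then show ?thesis
      using final by (simp add: score_def)
  next
    case False
    then obtain e where "e \<in> all_edges n"
      by (auto simp: legal_edges_def)
    then obtain a b where "a \<noteq> b" "a \<in> {1..n}" "b \<in> {1..n}"
      by (rule all_edgesE)
    then have n: "n \<ge> 2"
      by auto
    \<comment> \<open>Mini opens with \<open>{1, 2}\<close>: the total weight falls to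
      \<open>n - 2\<close>, which leaves room for the correction, and Max is to move.\<close>
    have sub: "{{1, 2}} \<subseteq> all_edges n"
      using doubleton_in_all_edges[of 1 2 n] n by simp
    have col': "three_colourable n {{1, 2}}"
      using three_colourable_insert_apex[OF col, of 2] by simp
    have legal: "{1, 2} \<in> legal_edges n ?P {}"
      using sub col' not_chi_gt_3_iff[OF sub] by (simp add: legal_edges_def)
    have "total_weight n {{1, 2}} + weight {} 2 = n - 1"
      using total_weight_insert_apex[of 2 n "{}"] n by (simp add: total_weight_empty)
    then have "total_weight n {{1, 2}} + 1 < n"
      using n by (simp add: weight_def)
    then have "winning_invariant n {{1, 2}}"
      using sub col' potential_le[of n "{{1, 2}}"] by (simp add: winning_invariant_def)
    then have "real (game_value n ?P Maxi {{1, 2}}) \<le> ?T"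
      using game_value_Maxi_le n by simp
    moreover have "game_value n ?P Mini {} \<le> game_value n ?P Maxi {{1, 2}}"
    proof -
      have "finite (legal_edges n ?P {})"
        by (rule finite_subset[OF _ finite_all_edges[of n]]) (auto simp: legal_edges_def)
      then show ?thesis
        using False legal by (subst game_value.simps) (auto intro!: Min_le)
    qed
    ultimately show ?thesis
      unfolding score_def by linarith
  qed
  show "real (score n ?P Mini) \<le> ?T \<and> real (score n ?P Maxi) \<le> ?T"
    using Mini Maxi by blast
qed

end
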